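(* A nonempty set $S \subseteq \mathbb{Z}^n$ is integrally convex if and only if $$\frac{y+y'}{2} \in \overline{S \cap N\!\left(\frac{y+y'}{2}\right)}$$ for every $y, y' \in S$ with $\|y - y'\|_\infty \ge 2$.
   Context: For $T \subseteq \mathbb{R}^n$, $\overline{T}$ denotes the convex hull of $T$. For $x \in \mathbb{R}^n$, the integral neighborhood is $N(x) = \{ z \in \mathbb{Z}^n \mid |x_i - z_i| < 1 \ (i=1,\dots,n)\}$. A nonempty set $S \subseteq \mathbb{Z}^n$ is called integrally convex if $\overline{S} = \bigcup_{x \in \mathbb{R}^n} \overline{S \cap N(x)}$; equivalently, if every $x \in \overline{S}$ satisfies $x \in \overline{S \cap N(x)}$. *)

theory Defs
  imports "HOL-Analysis.Analysis"
begin

definition integer_points :: "(real ^ 'n) set" where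
  "integer_points = {z. \<forall>i. z $ i \<in> \<int>}"

definition integral_nbhd :: "real ^ 'n \<Rightarrow> (real ^ 'n) set" where
  "integral_nbhd x = {z \<in> integer_points. \<forall>i. \<bar>x $ i - z $ i\<bar> < 1}"

definition integrally_convex :: "(real ^ 'n) set \<Rightarrow> bool" where
  "integrally_convex S \<longleftrightarrow>
     S \<noteq> {} \<and> S \<subseteq> integer_points \<and>
     convex hull S = (\<Union>x\<in>UNIV. convex hull (S \<inter> integral_nbhd x))"

end

theory Submission
  imports Defs
begin

text \<open>
  A point of the hull is written as a convex combination of points of S lying in some box. Among
  all such combinations choose one minimising the second moment, that is, a lowest point over x
  of the convex hull of the finitely many lifted points (p, p \<bullet> p). If two points of its support
  had distance at least 2, shifting weight from them to the points of S near their midpoint m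
  would lower the second moment, since those points are closer to m. So the support points
  pairwise differ by at most 1 in each coordinate, which places them in the integral
  neighbourhood of x.
\<close>

lemma integral_nbhdD:
  assumes "z \<in> integral_nbhd x"
  shows "z \<in> integer_points" "\<bar>x $ i - z $ i\<bar> < 1"
  using assms by (auto simp: integral_nbhd_def)

lemma integer_pointsE:
  assumes "z \<in> integer_points"
  obtains a where "z $ i = of_int a"
  using assms unfolding integer_points_def by (auto elim: Ints_cases)

lemma integer_points_close:
  assumes "p \<in> integer_points" "q \<in> integer_points" "\<bar>p $ i - q $ i\<bar> < 2"
  shows "\<bar>p $ i - q $ i\<bar> \<le> 1"
proof -
  obtain a b where "p $ i = of_int a" "q $ i = of_int b"
    using assms by (meson integer_pointsE)
  then have "p $ i - q $ i = of_int (a - b)" by simp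
  then show ?thesis using assms(3) by (simp flip: of_int_abs del: of_int_diff)
qed

text \<open>In each coordinate, \<open>x - p\<close> is the \<open>u\<close>-average of
  \<open>q - p\<close> over the support. By integrality each such difference has size at most 1, and
  \<open>q = p\<close> contributes 0, so for \<open>p\<close> in the support the average has size at
  most \<open>1 - u p < 1\<close>.\<close>

lemma convex_hull_integral_nbhdI:
  fixes F :: "(real ^ 'n) set"
  assumes fin: "finite F" and F: "F \<subseteq> integer_points"
    and u: "\<And>p. p \<in> F \<Longrightarrow> 0 \<le> u p" "sum u F = 1"
    and x: "x = (\<Sum>p\<in>F. u p *\<^sub>R p)"
    and close: "\<And>p q i. p \<in> F \<Longrightarrow> q \<in> F \<Longrightarrow> 0 < u p \<Longrightarrow> 0 < u q \<Longrightarrow> \<bar>q $ i - p $ i\<bar> < 2"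
  shows "x \<in> convex hull (F \<inter> integral_nbhd x)"
proof -
  define P where "P = {p \<in> F. 0 < u p}"
  have P: "finite P" "P \<subseteq> F" using fin by (auto simp: P_def)
  have zero: "u p = 0" if "p \<in> F - P" for p
    using that u(1)[of p] by (force simp: P_def)
  have sumP: "sum u P = 1"
    using sum.mono_neutral_left[OF fin P(2), of u] zero u(2) by simp
  have xP: "x = (\<Sum>p\<in>P. u p *\<^sub>R p)"
    unfolding x using sum.mono_neutral_right[OF fin P(2), of "\<lambda>p. u p *\<^sub>R p"] zero by simp
  have "p \<in> integral_nbhd x" if p: "p \<in> P" for p
  proof -
    have "\<bar>x $ i - p $ i\<bar> < 1" for i
    proof -
      have "x $ i - p $ i = (\<Sum>q\<in>P. u q * (q $ i - p $ i))"
        using sumP by (simp add: xP right_diff_distrib sum_subtractf flip: sum_distrib_right)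
      also have "\<dots> = (\<Sum>q\<in>P - {p}. u q * (q $ i - p $ i))"
        using p P by (simp add: sum.remove)
      also have "\<bar>\<dots>\<bar> \<le> (\<Sum>q\<in>P - {p}. u q)"
      proof (rule order_trans[OF sum_abs sum_mono])
        fix q assume q: "q \<in> P - {p}"
        have "\<bar>q $ i - p $ i\<bar> \<le> 1"
          using integer_points_close[of q p i] close[of p q i] p q F by (auto simp: P_def)
        then show "\<bar>u q * (q $ i - p $ i)\<bar> \<le> u q"
          using q by (auto simp: P_def abs_mult mult_left_le)
      qed
      also have "\<dots> = 1 - u p" using p P sumP by (simp add: sum_diff1)
      also have "\<dots> < 1" using p by (simp add: P_def)
      finally show ?thesis .
    qed
    then show ?thesis using p F by (auto simp: integral_nbhd_def P_def)
  qed
  then have "P \<subseteq> F \<inter> integral_nbhd x" using P(2) by auto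
  moreover have "x \<in> convex hull P"
    unfolding convex_hull_finite[OF P(1)] using sumP xP by (auto simp: P_def intro!: exI[of _ u])
  ultimately show ?thesis by (meson hull_mono subsetD)
qed

text \<open>The union in the definition only yields some center \<open>y\<close>, possibly different
  from \<open>x\<close>. Two points of \<open>integral_nbhd y\<close> differ by less than 2 in each
  coordinate, so the preceding lemma allows \<open>y\<close> to be replaced by
  \<open>x\<close>.\<close>

lemma integrally_convex_iff:
  fixes S :: "(real ^ 'n) set"
  assumes "S \<noteq> {}" "S \<subseteq> integer_points"
  shows "integrally_convex S \<longleftrightarrow> (\<forall>x\<in>convex hull S. x \<in> convex hull (S \<inter> integral_nbhd x))"
proof
  assume ic: "integrally_convex S"
  show "\<forall>x\<in>convex hull S. x \<in> convex hull (S \<inter> integral_nbhd x)"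
  proof
    fix x assume "x \<in> convex hull S"
    then obtain y where "x \<in> convex hull (S \<inter> integral_nbhd y)"
      using ic by (auto simp: integrally_convex_def)
    then obtain F u where F: "finite F" "F \<subseteq> S \<inter> integral_nbhd y" "\<forall>p\<in>F. 0 \<le> u p"
      "sum u F = 1" "(\<Sum>p\<in>F. u p *\<^sub>R p) = x"
      unfolding convex_hull_explicit by auto
    have "x \<in> convex hull (F \<inter> integral_nbhd x)"
    proof (rule convex_hull_integral_nbhdI[of F u])
      fix p q and i :: 'n assume "p \<in> F" "q \<in> F"
      then have "\<bar>y $ i - p $ i\<bar> < 1" "\<bar>y $ i - q $ i\<bar> < 1"
        using F(2) by (auto intro: integral_nbhdD)
      then show "\<bar>q $ i - p $ i\<bar> < 2" by linarith
    qed (use F assms in auto)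
    moreover have "F \<inter> integral_nbhd x \<subseteq> S \<inter> integral_nbhd x" using F(2) by auto
    ultimately show "x \<in> convex hull (S \<inter> integral_nbhd x)" by (meson hull_mono subsetD)
  qed
next
  assume "\<forall>x\<in>convex hull S. x \<in> convex hull (S \<inter> integral_nbhd x)"
  moreover have "convex hull (S \<inter> integral_nbhd x) \<subseteq> convex hull S" for x
    by (rule hull_mono) auto
  ultimately show "integrally_convex S"
    unfolding integrally_convex_def using assms by blast
qed

lemma finite_integer_points_box:
  "finite {z :: real ^ 'n. z \<in> integer_points \<and> (\<forall>i. \<bar>z $ i\<bar> \<le> real M)}" (is "finite ?B")
proof (rule finite_subset)
  let ?I = "real_of_int ` {- int M..int M}"
  show "?B \<subseteq> vec_lambda ` (PiE UNIV (\<lambda>i. ?I))"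
  proof
    fix z assume z: "z \<in> ?B"
    have "z $ i \<in> ?I" for i
    proof -
      obtain a where a: "z $ i = of_int a"
        using z integer_pointsE by blast
      moreover have "\<bar>z $ i\<bar> \<le> real M" using z by auto
      ultimately have "a \<in> {- int M..int M}" by (simp add: abs_le_iff)
      then show ?thesis using a by auto
    qed
    then show "z \<in> vec_lambda ` (PiE UNIV (\<lambda>i. ?I))"
      by (intro image_eqI[of _ _ "vec_nth z"]) auto
  qed
  show "finite (vec_lambda ` (PiE UNIV (\<lambda>i::'n. ?I)))"
    by (intro finite_imageI finite_PiE) auto
qed

text \<open>Ensures that weight moved towards a midpoint stays in the finite box. It matters that
  the bound is a natural number: \<open>z $ i\<close> is an integer of size below
  \<open>M + 1\<close>, hence of size at most \<open>M\<close>.\<close>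

lemma integral_nbhd_midpoint_box:
  assumes y: "\<bar>y $ i\<bar> \<le> real M" "\<bar>y' $ i\<bar> \<le> real M"
    and z: "z \<in> integral_nbhd ((1 / 2) *\<^sub>R (y + y'))"
  shows "\<bar>z $ i\<bar> \<le> real M"
proof -
  obtain a where a: "z $ i = of_int a"
    using integer_pointsE[OF integral_nbhdD(1)[OF z]] by blast
  have "\<bar>(y $ i + y' $ i) / 2 - z $ i\<bar> < 1" using integral_nbhdD(2)[OF z, of i] by simp
  then have "\<bar>z $ i\<bar> < real M + 1" using y by (auto simp: abs_less_iff abs_le_iff field_simps)
  then have "real_of_int \<bar>a\<bar> < real_of_int (int M + 1)" using a by simp
  then have "\<bar>a\<bar> \<le> int M" unfolding of_int_less_iff by simp
  then have "real_of_int \<bar>a\<bar> \<le> real_of_int (int M)" unfolding of_int_le_iff .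
  then show ?thesis using a by simp
qed

text \<open>Coordinatewise, \<open>z\<close> is within 1/2 of \<open>m\<close> and never farther
  from it than \<open>y\<close>. In a coordinate attaining the max norm, \<open>y\<close> is at
  distance at least 1 from \<open>m\<close>, which makes the comparison of the sums of squares
  strict.\<close>

lemma integral_nbhd_midpoint_closer:
  fixes y y' :: "real ^ 'n"
  assumes y: "y \<in> integer_points" "y' \<in> integer_points" and far: "2 \<le> infnorm (y - y')"
    and z: "z \<in> integral_nbhd m" and m: "m = (1 / 2) *\<^sub>R (y + y')"
  shows "(z - m) \<bullet> (z - m) < (y - m) \<bullet> (y - m)"
proof -
  have half: "\<bar>z $ i - m $ i\<bar> \<le> \<bar>y $ i - m $ i\<bar> \<and> \<bar>z $ i - m $ i\<bar> \<le> 1 / 2" for i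
  proof -
    obtain a b c where abc: "z $ i = of_int a" "y $ i = of_int b" "y' $ i = of_int c"
      using integral_nbhdD(1)[OF z] y by (meson integer_pointsE)
    have mi: "m $ i = (of_int b + of_int c) / 2" using abc by (simp add: m)
    have zm: "z $ i - m $ i = of_int (2 * a - b - c) / 2"
      and ym: "y $ i - m $ i = of_int (b - c) / 2"
      using abc mi by (auto simp: field_simps)
    have "\<bar>z $ i - m $ i\<bar> < 1" using integral_nbhdD(2)[OF z, of i] by linarith
    then have "\<bar>2 * a - b - c\<bar> < 2" unfolding zm by (simp flip: of_int_abs)
    \<comment> \<open>\<open>2 * a - b - c\<close> and \<open>b - c\<close> have the same parity: if
      even, the former is 0; if odd, it is 1 or -1 while the latter is nonzero.\<close>
    then have "\<bar>2 * a - b - c\<bar> \<le> 1" "\<bar>2 * a - b - c\<bar> \<le> \<bar>b - c\<bar>" by presburger+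
    then show ?thesis
      unfolding zm ym by (simp add: divide_right_mono flip: of_int_abs del: of_int_diff of_int_mult)
  qed
  obtain i where i: "infnorm (y - y') = \<bar>(y - y') $ i\<bar>"
  proof -
    have "infnorm (y - y') \<in> (\<lambda>b. \<bar>(y - y') \<bullet> b\<bar>) ` Basis"
      unfolding infnorm_Max by (rule Max_in) auto
    then show ?thesis using that by (auto simp: Basis_vec_def inner_axis)
  qed
  have "\<bar>z $ i - m $ i\<bar> < \<bar>y $ i - m $ i\<bar>"
    using half[of i] far i by (simp add: m field_simps)
  then have "(z $ i - m $ i)\<^sup>2 < (y $ i - m $ i)\<^sup>2" by (metis abs_ge_zero power2_abs power_strict_mono zero_less_numeral)
  moreover have "(z $ j - m $ j)\<^sup>2 \<le> (y $ j - m $ j)\<^sup>2" for j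
    using half[of j] by (simp add: abs_le_square_iff)
  ultimately have "(\<Sum>j\<in>UNIV. (z $ j - m $ j)\<^sup>2) < (\<Sum>j\<in>UNIV. (y $ j - m $ j)\<^sup>2)"
    by (intro sum_strict_mono_ex1) auto
  then show ?thesis by (simp add: inner_vec_def power2_eq_square)
qed

text \<open>Weight \<open>e\<close> is taken from each of \<open>p\<close> and \<open>p'\<close>,
  and the total \<open>2 * e\<close> is redistributed over \<open>T\<close> in the proportions that
  represent \<open>q\<close>.\<close>

lemma convex_hull_shift_weight:
  fixes T :: "'a :: real_vector set"
  assumes T: "finite T" and u: "\<And>p. p \<in> T \<Longrightarrow> 0 \<le> u p" "sum u T = 1"
    and pp: "p \<in> T" "p' \<in> T" "p \<noteq> p'" and upos: "0 < u p" "0 < u p'"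
    and q: "q \<in> convex hull T"
  shows "\<exists>e>0. (\<Sum>r\<in>T. u r *\<^sub>R r) + e *\<^sub>R (2 *\<^sub>R q - p - p') \<in> convex hull T"
proof -
  obtain v where v: "\<forall>r\<in>T. 0 \<le> v r" "sum v T = 1" "(\<Sum>r\<in>T. v r *\<^sub>R r) = q"
    using q unfolding convex_hull_finite[OF T] by auto
  \<comment> \<open>The largest amount that can be removed from both points; as they are distinct,
    neither weight loses more than \<open>e\<close>.\<close>
  define e where "e = min (u p) (u p')"
  have e: "0 < e" "e \<le> u p" "e \<le> u p'" using upos by (auto simp: e_def)
  \<comment> \<open>The point mass at \<open>a\<close>, so that \<open>p\<close> and
    \<open>p'\<close> are also weighted sums over \<open>T\<close> and the total weight changes by
    \<open>e * (2 - 1 - 1) = 0\<close>.\<close>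
  define d :: "'a \<Rightarrow> 'a \<Rightarrow> real" where "d a r = (if r = a then 1 else 0)" for a r
  define w where "w r = u r + e * (2 * v r - d p r - d p' r)" for r
  have d: "sum (d a) T = 1" "(\<Sum>r\<in>T. d a r *\<^sub>R r) = a" if "a \<in> T" for a
    using that T by (auto simp: d_def if_distrib[of "\<lambda>c. c *\<^sub>R _"] cong: if_cong)
  have "0 \<le> w r" if "r \<in> T" for r
  proof -
    have "e * (d p r + d p' r) \<le> u r" using e u(1)[OF that] pp(3) by (auto simp: d_def)
    moreover have "0 \<le> e * (2 * v r)" using e v that by simp
    ultimately show ?thesis by (simp add: w_def algebra_simps)
  qed
  moreover have "sum w T = 1"
    using u(2) v(2) d pp
    by (simp add: w_def sum.distrib sum_subtractf flip: sum_distrib_left)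
  moreover have "(\<Sum>r\<in>T. w r *\<^sub>R r) = (\<Sum>r\<in>T. u r *\<^sub>R r) + e *\<^sub>R (2 *\<^sub>R q - p - p')"
  proof -
    have "(\<Sum>r\<in>T. w r *\<^sub>R r) = (\<Sum>r\<in>T. u r *\<^sub>R r) +
        e *\<^sub>R (2 *\<^sub>R (\<Sum>r\<in>T. v r *\<^sub>R r) - (\<Sum>r\<in>T. d p r *\<^sub>R r) - (\<Sum>r\<in>T. d p' r *\<^sub>R r))"
      by (simp add: w_def scaleR_left_distrib scaleR_left_diff_distrib scaleR_right_diff_distrib
          right_diff_distrib sum.distrib sum_subtractf scaleR_sum_right)
    then show ?thesis using v(3) d pp by simp
  qed
  ultimately show ?thesis
    unfolding convex_hull_finite[OF T] using e(1) by (auto intro!: exI[of _ e] exI[of _ w])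
qed

text \<open>The point over \<open>m\<close> lies strictly below the midpoint of the chord joining
  the lifts of \<open>y\<close> and \<open>y'\<close>. The variance identity gives
  \<open>s - m \<bullet> m\<close> as the mean squared distance to \<open>m\<close>, which is less
  than that of \<open>y\<close>; the latter equals
  \<open>(y \<bullet> y + y' \<bullet> y') / 2 - m \<bullet> m\<close>.\<close>

lemma lift_below_midpoint:
  fixes y y' m :: "'a :: real_inner"
  assumes m: "m = (1 / 2) *\<^sub>R (y + y')" "m \<in> convex hull A"
    and closer: "\<And>z. z \<in> A \<Longrightarrow> (z - m) \<bullet> (z - m) < (y - m) \<bullet> (y - m)"
  obtains s where "(m, s) \<in> convex hull (\<lambda>p. (p, p \<bullet> p)) ` A" "2 * s < y \<bullet> y + y' \<bullet> y'"
proof -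
  obtain F v where F: "finite F" "F \<subseteq> A" "\<forall>p\<in>F. 0 \<le> v p" "sum v F = 1" "(\<Sum>p\<in>F. v p *\<^sub>R p) = m"
    using m(2) unfolding convex_hull_explicit by auto
  define s where "s = (\<Sum>p\<in>F. v p * (p \<bullet> p))"
  have "(\<Sum>p\<in>F. v p *\<^sub>R (p, p \<bullet> p)) = (m, s)"
    using F(5) by (simp add: s_def scaleR_Pair sum_prod)
  moreover have "(\<Sum>p\<in>F. v p *\<^sub>R (p, p \<bullet> p)) \<in> convex hull (\<lambda>p. (p, p \<bullet> p)) ` A"
    using F by (intro convex_sum) (auto intro: hull_inc)
  ultimately have "(m, s) \<in> convex hull (\<lambda>p. (p, p \<bullet> p)) ` A" by simp
  moreover have "2 * s < y \<bullet> y + y' \<bullet> y'"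
  proof -
    have "(\<Sum>p\<in>F. v p * ((p - m) \<bullet> (p - m))) = s - 2 * (\<Sum>p\<in>F. v p * (p \<bullet> m)) + sum v F * (m \<bullet> m)"
      by (simp add: s_def sum_distrib_left sum_distrib_right inner_commute
          algebra_simps sum.distrib sum_subtractf)
    moreover have "(\<Sum>p\<in>F. v p * (p \<bullet> m)) = m \<bullet> m"
      using inner_sum_left[of "\<lambda>p. v p *\<^sub>R p" F m] F(5) by simp
    ultimately have "s - m \<bullet> m = (\<Sum>p\<in>F. v p * ((p - m) \<bullet> (p - m)))" using F by simp
    also have "\<dots> < (\<Sum>p\<in>F. v p * ((y - m) \<bullet> (y - m)))"
    proof -
      have "\<exists>p\<in>F. 0 < v p" using F(3,4) by (metis less_eq_real_def sum.neutral zero_neq_one)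
      moreover have "(p - m) \<bullet> (p - m) < (y - m) \<bullet> (y - m)" if "p \<in> F" for p
        using that F(2) closer by blast
      ultimately show ?thesis
        using F(1,3) by (intro sum_strict_mono_ex1) (auto intro: mult_left_mono less_imp_le mult_strict_left_mono)
    qed
    also have "\<dots> = (y - m) \<bullet> (y - m)" using F(4) by (simp flip: sum_distrib_right)
    finally show ?thesis
      by (simp add: m(1) algebra_simps inner_commute)
  qed
  ultimately show ?thesis using that by blast
qed

theorem theorem2p3:
  fixes S :: "(real ^ 'n) set"
  assumes "S \<noteq> {}" and "S \<subseteq> integer_points"
  shows "integrally_convex S \<longleftrightarrow>
    (\<forall>y\<in>S. \<forall>y'\<in>S. infnorm (y - y') \<ge> 2 \<longrightarrow>
       (1 / 2) *\<^sub>R (y + y') \<in> convex hull (S \<inter> integral_nbhd ((1 / 2) *\<^sub>R (y + y'))))"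
  unfolding integrally_convex_iff[OF assms]
proof (intro iffI ballI impI)
  fix y y' assume ic: "\<forall>x\<in>convex hull S. x \<in> convex hull (S \<inter> integral_nbhd x)"
    and y: "y \<in> S" "y' \<in> S"
  have "(1 / 2) *\<^sub>R y + (1 / 2) *\<^sub>R y' \<in> convex hull S"
    using y by (intro convexD[OF convex_convex_hull]) (auto intro: hull_inc)
  then show "(1 / 2) *\<^sub>R (y + y') \<in> convex hull (S \<inter> integral_nbhd ((1 / 2) *\<^sub>R (y + y')))"
    using ic by (simp add: scaleR_right_distrib)
next
  fix x
  assume mid: "\<forall>y\<in>S. \<forall>y'\<in>S. infnorm (y - y') \<ge> 2 \<longrightarrow>
       (1 / 2) *\<^sub>R (y + y') \<in> convex hull (S \<inter> integral_nbhd ((1 / 2) *\<^sub>R (y + y')))"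
    and "x \<in> convex hull S"
  then obtain F0 where F0: "finite F0" "F0 \<subseteq> S" "x \<in> convex hull F0"
    unfolding convex_hull_explicit by blast
  obtain M where M: "\<forall>p\<in>F0. norm p \<le> real M"
  proof -
    obtain b where "\<forall>p\<in>F0. norm p \<le> b"
      using finite_imp_bounded[OF F0(1)] by (auto simp: bounded_iff)
    then show ?thesis using that real_arch_simple[of b] by (meson order_trans)
  qed
  \<comment> \<open>\<open>S\<close> may be infinite, so the minimisation is confined to a finite
    box. All points of \<open>S\<close> in the box are kept, not just \<open>F0\<close>, so that the
    points of \<open>S\<close> near midpoints are available for the exchange.\<close>
  define A where "A = {z \<in> S. \<forall>i. \<bar>z $ i\<bar> \<le> real M}"
  have finA: "finite A"
    by (rule finite_subset[OF _ finite_integer_points_box[of M]]) (use assms in \<open>auto simp: A_def\<close>)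
  have A: "A \<subseteq> integer_points" "A \<subseteq> S" using assms by (auto simp: A_def)
  have "F0 \<subseteq> A"
    using F0 M by (auto simp: A_def intro: order_trans[OF component_le_norm_cart])
  then have "x \<in> convex hull A" using F0 by (meson hull_mono subsetD)
  define L :: "real ^ 'n \<Rightarrow> (real ^ 'n) \<times> real" where "L = (\<lambda>p. (p, p \<bullet> p))"
  have injL: "inj_on L A" by (auto simp: L_def inj_on_def)
  have finT: "finite (L ` A)" using finA by simp
  \<comment> \<open>The fibre over \<open>x\<close>: its second coordinates are the second moments
    of the representations of \<open>x\<close> by points of \<open>A\<close>.\<close>
  define K where "K = {t \<in> convex hull (L ` A). fst t = x}"
  have "compact K"
  proof -
    have "K = convex hull (L ` A) \<inter> fst -` {x}" by (auto simp: K_def)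
    moreover have "closed (fst -` {x} :: ((real ^ 'n) \<times> real) set)"
      by (intro closed_vimage) (auto intro: continuous_intros)
    ultimately show ?thesis
      using finite_imp_compact_convex_hull[OF finT] by (simp add: compact_Int_closed)
  qed
  moreover have "K \<noteq> {}"
  proof -
    have "x \<in> fst ` (convex hull (L ` A))"
      using \<open>x \<in> convex hull A\<close>
      by (simp add: convex_hull_linear_image[OF linear_fst] image_image L_def)
    then show ?thesis by (auto simp: K_def)
  qed
  ultimately obtain t where t: "t \<in> K" and min: "\<forall>t'\<in>K. snd t \<le> snd t'"
    using continuous_attains_inf[of K snd] continuous_on_snd[OF continuous_on_id] by blast
  obtain u where u: "\<forall>p\<in>L ` A. 0 \<le> u p" "sum u (L ` A) = 1" "(\<Sum>p\<in>L ` A. u p *\<^sub>R p) = t"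
    using t unfolding K_def convex_hull_finite[OF finT] by auto
  have near: "infnorm (q - p) < 2" if p: "p \<in> A" "0 < u (L p)" and q: "q \<in> A" "0 < u (L q)" for p q
  proof (rule ccontr)
    assume "\<not> infnorm (q - p) < 2"
    then have far: "2 \<le> infnorm (q - p)" by simp
    define m where "m = (1 / 2) *\<^sub>R (q + p)"
    have sub: "S \<inter> integral_nbhd m \<subseteq> A"
      using p(1) q(1) integral_nbhd_midpoint_box[of q _ M p] by (auto simp: A_def m_def)
    have "m \<in> convex hull (S \<inter> integral_nbhd m)"
      using mid far p(1) q(1) A(2) unfolding m_def by blast
    then obtain s where s: "(m, s) \<in> convex hull (L ` (S \<inter> integral_nbhd m))"
      "2 * s < q \<bullet> q + p \<bullet> p"
      using lift_below_midpoint[OF m_def, of "S \<inter> integral_nbhd m"]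
        integral_nbhd_midpoint_closer[OF _ _ far _ m_def] p(1) q(1) A(1)
      unfolding L_def by blast
    have "L q \<noteq> L p" using far by (auto simp: L_def infnorm_0)
    moreover have "(m, s) \<in> convex hull (L ` A)"
      using s(1) hull_mono[OF image_mono[OF sub, of L], of convex] by (rule subsetD[rotated])
    ultimately obtain e where e: "0 < e" "t + e *\<^sub>R (2 *\<^sub>R (m, s) - L q - L p) \<in> convex hull (L ` A)"
      using convex_hull_shift_weight[OF finT, of u "L q" "L p" "(m, s)"] u p q by auto
    \<comment> \<open>Since \<open>m\<close> is the midpoint of \<open>q\<close> and
      \<open>p\<close>, the shift is vertical and stays in \<open>K\<close>; its height
      \<open>e * (2 * s - q \<bullet> q - p \<bullet> p)\<close> is negative, against the minimality
      of \<open>t\<close>.\<close>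
    have "fst (t + e *\<^sub>R (2 *\<^sub>R (m, s) - L q - L p)) = x"
      using t by (simp add: K_def L_def m_def)
    then have "snd t \<le> snd (t + e *\<^sub>R (2 *\<^sub>R (m, s) - L q - L p))"
      using min e(2) unfolding K_def by blast
    then have "0 \<le> e * (2 * s - q \<bullet> q - p \<bullet> p)" by (simp add: L_def)
    then show False using e(1) s(2) by (simp add: zero_le_mult_iff)
  qed
  have "x \<in> convex hull (A \<inter> integral_nbhd x)"
  proof (rule convex_hull_integral_nbhdI[of A "u \<circ> L"])
    show "sum (u \<circ> L) A = 1" using u(2) by (simp add: sum.reindex[OF injL])
    \<comment> \<open>The first coordinate of the minimal lifted combination is a representation of
      \<open>x\<close>; injectivity of \<open>L\<close> lets its weights be indexed by
      \<open>A\<close>.\<close>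
    have "x = fst (\<Sum>p\<in>L ` A. u p *\<^sub>R p)" using t u(3) by (simp add: K_def)
    then show "x = (\<Sum>p\<in>A. (u \<circ> L) p *\<^sub>R p)"
      by (simp add: sum.reindex[OF injL] fst_sum) (simp add: L_def)
    fix p q i assume "p \<in> A" "q \<in> A" "0 < (u \<circ> L) p" "0 < (u \<circ> L) q"
    then show "\<bar>q $ i - p $ i\<bar> < 2"
      using near[of p q] component_le_infnorm_cart[of "q - p" i] by simp
  qed (use finA A u(1) in auto)
  moreover have "A \<inter> integral_nbhd x \<subseteq> S \<inter> integral_nbhd x" using A(2) by auto
  ultimately show "x \<in> convex hull (S \<inter> integral_nbhd x)" by (meson hull_mono subsetD)
qed

end
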